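(* The map $\omega\star-\colon\tilde f\mapsto\omega\star\tilde f$, sending continuous Mackey sections of $E$ to Mackey sections of $F$, where $$(\omega\star\tilde f)(h,b):=\int_G\omega(k,b)\big(\tilde f(hk,b)\big)\,d\mu_b(k)\qquad(h\in G,\ b\in B),$$ is $G$-equivariant; that is, $\omega\star(g.\tilde f)=g.(\omega\star\tilde f)$ for all $g\in G$ and all continuous Mackey sections $\tilde f$ of $E$.
   Context: $G$ is a Hausdorff topological group and $B$ is a Hausdorff topological space with a continuous left action $G\times B\to B$, $(g,b)\mapsto g.b$. A $G$-equivariant real vector bundle $E\to B$ is a (finite-rank, locally trivial) real vector bundle with a continuous left $G$-action on $E$ such that the projection is $G$-equivariant and each $g\in G$ maps the fiber $E_b$ linearly to $E_{g.b}$. Let $E\to B$ and $F\to B$ be $G$-equivariant real vector bundles. Mackey sections: A Mackey section of $E$ is a map $\tilde f\colon G\times B\to E$ with $\tilde f(h,b)\in E_b$ and $\tilde f(h,g.b)=g.\tilde f(hg,b)$ for all $g,h\in G$, $b\in B$ (and similarly for $F$). $G$ acts on Mackey sections by $(g.\tilde f)(h,b):=\tilde f(g^{-1}h,b)$. Measures: $\{\mu_b\colon\mathcal B(G)\to[0,\infty]\}_{b\in B}$ is a family of locally finite Borel measures on $G$ with $\mu_{g.b}=c_{g*}\mu_b$ for all $g\in G$, $b\in B$, where $c_g\colon G\to G$, $h\mapsto ghg^{-1}$ and $c_{g*}$ denotes pushforward. The family is continuous: for every compactly supported continuous $f'\colon G\to\mathbb R$ the function $B\to\mathbb R$, $b\mapsto\int_G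 f'\,d\mu_b$ is continuous. Filter: $\mathrm{Hom}(E,F)\to B$ is the bundle with fiber $\mathrm{Hom}(E_b,F_b)$ over $b$. The filter $\omega\colon G\times B\to\mathrm{Hom}(E,F)$ is a continuous map with $\omega(h,b)\in\mathrm{Hom}(E_b,F_b)$ such that $\omega(-,b)\colon G\to\mathrm{Hom}(E_b,F_b)$ has compact support for each $b\in B$ and $$\omega(ghg^{-1},g.b)(g.v)=g.\omega(h,b)(v)$$ for all $g,h\in G$, $b\in B$, $v\in E_b$. *)

theory Defs
  imports "HOL-Analysis.Analysis"
begin

text \<open>
  The library's class of (not necessarily commutative) topological groups is
  \<^class>\<open>topological_group_add\<close>, so the group \<open>G\<close> is written additively throughout:
  \<open>h k\<close> is \<open>h + k\<close>, \<open>g\<^sup>-\<^sup>1 h\<close> is \<open>- g + h\<close> and \<open>g h g\<^sup>-\<^sup>1\<close> is \<open>g + h - g\<close>.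
\<close>

definition continuous_group_action ::
    "('g::topological_group_add \<Rightarrow> 'x::topological_space \<Rightarrow> 'x) \<Rightarrow> bool" where
  "continuous_group_action a \<longleftrightarrow>
     (\<forall>x. a 0 x = x) \<and> (\<forall>g h x. a (g + h) x = a g (a h x)) \<and>
     continuous_on UNIV (\<lambda>(g, x). a g x)"


subsection \<open>Real vector bundles\<close>

text \<open>
  The type \<open>'e\<close> is the total space. The operations \<open>vadd\<close> and \<open>vscale\<close> are meaningful only
  within a fibre; \<open>vzero\<close> is the zero section.
\<close>

record ('b, 'e) vbundle =
  proj :: "'e \<Rightarrow> 'b"
  vadd :: "'e \<Rightarrow> 'e \<Rightarrow> 'e"
  vscale :: "real \<Rightarrow> 'e \<Rightarrow> 'e"
  vzero :: "'b \<Rightarrow> 'e"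

definition fiber :: "('b, 'e) vbundle \<Rightarrow> 'b \<Rightarrow> 'e set" where
  "fiber E b = proj E -` {b}"

definition fiber_vector_space :: "('b, 'e) vbundle \<Rightarrow> 'b \<Rightarrow> bool" where
  "fiber_vector_space E b \<longleftrightarrow>
     vzero E b \<in> fiber E b \<and>
     (\<forall>x\<in>fiber E b. \<forall>y\<in>fiber E b. vadd E x y \<in> fiber E b) \<and>
     (\<forall>c. \<forall>x\<in>fiber E b. vscale E c x \<in> fiber E b) \<and>
     (\<forall>x\<in>fiber E b. \<forall>y\<in>fiber E b. \<forall>z\<in>fiber E b.
        vadd E (vadd E x y) z = vadd E x (vadd E y z)) \<and>
     (\<forall>x\<in>fiber E b. \<forall>y\<in>fiber E b. vadd E x y = vadd E y x) \<and>
     (\<forall>x\<in>fiber E b. vadd E (vzero E b) x = x) \<and>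
     (\<forall>x\<in>fiber E b. \<exists>y\<in>fiber E b. vadd E x y = vzero E b) \<and>
     (\<forall>c. \<forall>x\<in>fiber E b. \<forall>y\<in>fiber E b.
        vscale E c (vadd E x y) = vadd E (vscale E c x) (vscale E c y)) \<and>
     (\<forall>c d. \<forall>x\<in>fiber E b. vscale E (c + d) x = vadd E (vscale E c x) (vscale E d x)) \<and>
     (\<forall>c d. \<forall>x\<in>fiber E b. vscale E (c * d) x = vscale E c (vscale E d x)) \<and>
     (\<forall>x\<in>fiber E b. vscale E 1 x = x)"

definition fiber_linear ::
    "('b, 'e) vbundle \<Rightarrow> 'b \<Rightarrow> ('b, 'f) vbundle \<Rightarrow> 'b \<Rightarrow> ('e \<Rightarrow> 'f) \<Rightarrow> bool" where
  "fiber_linear E b F c T \<longleftrightarrow>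
     (\<forall>x\<in>fiber E b. T x \<in> fiber F c) \<and>
     (\<forall>x\<in>fiber E b. \<forall>y\<in>fiber E b. T (vadd E x y) = vadd F (T x) (T y)) \<and>
     (\<forall>r. \<forall>x\<in>fiber E b. T (vscale E r x) = vscale F r (T x))"

definition fiber_functional :: "('b, 'e) vbundle \<Rightarrow> 'b \<Rightarrow> ('e \<Rightarrow> real) \<Rightarrow> bool" where
  "fiber_functional E b l \<longleftrightarrow>
     (\<forall>x\<in>fiber E b. \<forall>y\<in>fiber E b. l (vadd E x y) = l x + l y) \<and>
     (\<forall>r. \<forall>x\<in>fiber E b. l (vscale E r x) = r * l x)"

text \<open>
  Only the second component \<open>\<phi>\<close> of a local trivialization \<open>E|\<^sub>U \<rightarrow> U \<times> \<real>\<^sup>n\<close> is named. The model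
  fibre is the library's \<open>Euclidean_space n\<close>, consisting of the sequences that vanish from
  index \<open>n\<close> on.
\<close>

definition local_trivialization ::
    "('b::topological_space, 'e::topological_space) vbundle \<Rightarrow> 'b set \<Rightarrow> nat \<Rightarrow>
      ('e \<Rightarrow> nat \<Rightarrow> real) \<Rightarrow> bool" where
  "local_trivialization E U n \<phi> \<longleftrightarrow>
     open U \<and>
     homeomorphic_map (top_of_set (proj E -` U))
       (prod_topology (top_of_set U) (Euclidean_space n)) (\<lambda>x. (proj E x, \<phi> x)) \<and>
     (\<forall>b\<in>U. \<forall>i. fiber_functional E b (\<lambda>x. \<phi> x i))"

definition vector_bundle ::
    "('b::topological_space, 'e::topological_space) vbundle \<Rightarrow> bool" where
  "vector_bundle E \<longleftrightarrow>
     continuous_on UNIV (proj E) \<and>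
     (\<forall>b. fiber_vector_space E b) \<and>
     (\<forall>b. \<exists>U n \<phi>. b \<in> U \<and> local_trivialization E U n \<phi>)"

definition equivariant_vector_bundle ::
    "('g::topological_group_add \<Rightarrow> 'b::topological_space \<Rightarrow> 'b) \<Rightarrow>
      ('b, 'e::topological_space) vbundle \<Rightarrow> ('g \<Rightarrow> 'e \<Rightarrow> 'e) \<Rightarrow> bool" where
  "equivariant_vector_bundle actB E actE \<longleftrightarrow>
     vector_bundle E \<and>
     continuous_group_action actE \<and>
     (\<forall>g x. proj E (actE g x) = actB g (proj E x)) \<and>
     (\<forall>g b. fiber_linear E b E (actB g b) (actE g))"


subsection \<open>The bundle Hom(E, F)\<close>

definition hom_fiber :: "('b, 'e) vbundle \<Rightarrow> ('b, 'f) vbundle \<Rightarrow> 'b \<Rightarrow> ('e \<Rightarrow> 'f) set" where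
  "hom_fiber E F b = {T \<in> extensional (fiber E b). fiber_linear E b F b T}"

text \<open>
  The matrix of \<open>T\<close> over \<open>b\<close> with respect to local trivializations \<open>\<phi>\<close> of \<open>E\<close> (of rank \<open>n\<close>)
  and \<open>\<psi>\<close> of \<open>F\<close>, extended by zero outside the index range. Column \<open>j\<close> is the image of the
  vector of the fibre that \<open>\<phi>\<close> sends to the \<open>j\<close>-th standard basis vector.
\<close>

definition hom_matrix ::
    "('b, 'e) vbundle \<Rightarrow> nat \<Rightarrow> ('e \<Rightarrow> nat \<Rightarrow> real) \<Rightarrow> ('f \<Rightarrow> nat \<Rightarrow> real) \<Rightarrow>
      'b \<Rightarrow> ('e \<Rightarrow> 'f) \<Rightarrow> nat \<times> nat \<Rightarrow> real" where
  "hom_matrix E n \<phi> \<psi> b T =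
     (\<lambda>(i, j). if j < n
        then \<psi> (T (inv_into (fiber E b) \<phi> (\<lambda>k. if k = j then 1 else 0))) i else 0)"

text \<open>
  A point of the total space of \<open>Hom(E, F)\<close> is a pair of a base point \<open>b\<close> and an element of
  \<open>Hom(E\<^sub>b, F\<^sub>b)\<close>. The topology is generated by the preimages of open sets under the bundle
  charts \<open>(b, T) \<mapsto> (b, matrix of T)\<close> over intersections of trivializing open sets; here
  matrices live in \<open>nat \<times> nat \<Rightarrow> real\<close> with the product topology.
\<close>

definition hom_topology ::
    "('b::topological_space, 'e::topological_space) vbundle \<Rightarrow>
      ('b, 'f::topological_space) vbundle \<Rightarrow> ('b \<times> ('e \<Rightarrow> 'f)) topology" where
  "hom_topology E F = topology_generated_by
     {{(b, T). b \<in> U \<inter> V \<and> T \<in> hom_fiber E F b \<and> (b, hom_matrix E n \<phi> \<psi> b T) \<in> W}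
       | U n \<phi> V m \<psi> W.
         local_trivialization E U n \<phi> \<and> local_trivialization F V m \<psi> \<and> open W}"


subsection \<open>Mackey sections, measures and filters\<close>

definition mackey_section ::
    "('g::group_add \<Rightarrow> 'b \<Rightarrow> 'b) \<Rightarrow> ('b, 'e) vbundle \<Rightarrow> ('g \<Rightarrow> 'e \<Rightarrow> 'e) \<Rightarrow>
      ('g \<times> 'b \<Rightarrow> 'e) \<Rightarrow> bool" where
  "mackey_section actB E actE f \<longleftrightarrow>
     (\<forall>h b. f (h, b) \<in> fiber E b) \<and>
     (\<forall>g h b. f (h, actB g b) = actE g (f (h + g, b)))"

definition mackey_act ::
    "'g::group_add \<Rightarrow> ('g \<times> 'b \<Rightarrow> 'e) \<Rightarrow> 'g \<times> 'b \<Rightarrow> 'e" where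
  "mackey_act g f = (\<lambda>(h, b). f (- g + h, b))"

definition locally_finite_borel_measure :: "'g::topological_space measure \<Rightarrow> bool" where
  "locally_finite_borel_measure M \<longleftrightarrow>
     sets M = sets borel \<and> (\<forall>x. \<exists>U. open U \<and> x \<in> U \<and> emeasure M U < \<infinity>)"

definition continuous_measure_family ::
    "('b::topological_space \<Rightarrow> 'g::topological_space measure) \<Rightarrow> bool" where
  "continuous_measure_family \<mu> \<longleftrightarrow>
     (\<forall>f::'g \<Rightarrow> real. continuous_on UNIV f \<longrightarrow> compact (closure {x. f x \<noteq> 0}) \<longrightarrow>
        continuous_on UNIV (\<lambda>b. integral\<^sup>L (\<mu> b) f))"

definition equivariant_measure_family ::
    "('g::topological_group_add \<Rightarrow> 'b \<Rightarrow> 'b) \<Rightarrow> ('b \<Rightarrow> 'g measure) \<Rightarrow> bool" where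
  "equivariant_measure_family actB \<mu> \<longleftrightarrow>
     (\<forall>g b. \<mu> (actB g b) = distr (\<mu> b) borel (\<lambda>h. g + h - g))"

definition mackey_filter ::
    "('g::topological_group_add \<Rightarrow> 'b::topological_space \<Rightarrow> 'b) \<Rightarrow>
      ('b, 'e::topological_space) vbundle \<Rightarrow> ('g \<Rightarrow> 'e \<Rightarrow> 'e) \<Rightarrow>
      ('b, 'f::topological_space) vbundle \<Rightarrow> ('g \<Rightarrow> 'f \<Rightarrow> 'f) \<Rightarrow>
      ('g \<Rightarrow> 'b \<Rightarrow> 'e \<Rightarrow> 'f) \<Rightarrow> bool" where
  "mackey_filter actB E actE F actF \<omega> \<longleftrightarrow>
     (\<forall>h b. \<omega> h b \<in> hom_fiber E F b) \<and>
     continuous_map euclidean (hom_topology E F) (\<lambda>(h, b). (b, \<omega> h b)) \<and>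
     (\<forall>b. compact (closure {h. \<exists>v\<in>fiber E b. \<omega> h b v \<noteq> vzero F b})) \<and>
     (\<forall>g h b. \<forall>v\<in>fiber E b.
        \<omega> (g + h - g) (actB g b) (actE g v) = actF g (\<omega> h b v))"


subsection \<open>Integration in a fibre and the convolution\<close>

text \<open>
  The fibres are not types, so the library's Bochner integral does not apply to them directly.
  A function into a finite-dimensional fibre is integrated componentwise, that is, along every
  linear functional.
\<close>

definition has_fiber_integral ::
    "('b, 'f) vbundle \<Rightarrow> 'b \<Rightarrow> 'g measure \<Rightarrow> ('g \<Rightarrow> 'f) \<Rightarrow> 'f \<Rightarrow> bool" where
  "has_fiber_integral F b M s v \<longleftrightarrow>
     v \<in> fiber F b \<and>
     (\<forall>l. fiber_functional F b l \<longrightarrow> has_bochner_integral M (\<lambda>k. l (s k)) (l v))"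

definition fiber_integral ::
    "('b, 'f) vbundle \<Rightarrow> 'b \<Rightarrow> 'g measure \<Rightarrow> ('g \<Rightarrow> 'f) \<Rightarrow> 'f" where
  "fiber_integral F b M s = (THE v. has_fiber_integral F b M s v)"

definition mackey_conv ::
    "('b, 'f) vbundle \<Rightarrow> ('b \<Rightarrow> 'g::group_add measure) \<Rightarrow> ('g \<Rightarrow> 'b \<Rightarrow> 'e \<Rightarrow> 'f) \<Rightarrow>
      ('g \<times> 'b \<Rightarrow> 'e) \<Rightarrow> 'g \<times> 'b \<Rightarrow> 'f" where
  "mackey_conv F \<mu> \<omega> f =
     (\<lambda>(h, b). fiber_integral F b (\<mu> b) (\<lambda>k. \<omega> k b (f (h + k, b))))"

end

theory Submission
  imports Defs
begin

text \<open>
  In a trivialization over \<open>b\<close> every fibre functional of the integrand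
  \<open>k \<mapsto> \<omega>(k,b)(f(hk,b))\<close> is a finite sum of products of continuous functions and vanishes
  outside a compact set, so the integral exists and is unique. The Mackey property follows from
  the change of variables \<open>k \<mapsto> gkg\<^sup>-\<^sup>1\<close>, under which the integrand over \<open>g.b\<close> becomes the
  \<open>g\<close>-translate of the integrand over \<open>b\<close>; equivariance is associativity in \<open>G\<close>.
\<close>

text \<open>Finitely many open sets of finite measure cover \<open>K\<close>, so \<open>K\<close>
  has finite measure, and \<open>u\<close> is bounded on \<open>K\<close> by continuity. The
  Hausdorff property makes \<open>K\<close> closed, hence Borel.\<close>

lemma continuous_compact_support_integrable:
  fixes u :: "'g::t2_space \<Rightarrow> real"
  assumes M: "locally_finite_borel_measure M"
    and u: "continuous_on UNIV u" and K: "compact K" and zero: "\<And>x. x \<notin> K \<Longrightarrow> u x = 0"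
  shows "integrable M u"
proof -
  have sets: "sets M = sets borel"
    using M by (simp add: locally_finite_borel_measure_def)
  obtain N where N: "\<And>x. open (N x)" "\<And>x. x \<in> N x" "\<And>x. emeasure M (N x) < \<infinity>"
    using M by (auto simp: locally_finite_borel_measure_def intro: that dest!: choice)
  obtain D where D: "D \<subseteq> K" "finite D" "K \<subseteq> (\<Union>x\<in>D. N x)"
    by (rule compactE_image[OF K, of K N]) (use N in auto)
  have NM: "N x \<in> sets M" for x
    using N(1) sets by auto
  have KM: "K \<in> sets M"
    using sets compact_imp_closed[OF K] by auto
  have "emeasure M K \<le> emeasure M (\<Union>x\<in>D. N x)"
    using D NM by (intro emeasure_mono) auto
  also have "\<dots> \<le> (\<Sum>x\<in>D. emeasure M (N x))"
    using D NM by (intro emeasure_subadditive_finite) auto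
  also have "\<dots> < \<infinity>"
    using N(3) D(2) by (simp add: less_top)
  finally have fin: "emeasure M K < \<infinity>" .
  have "compact (u ` K)"
    using K u continuous_on_subset compact_continuous_image by blast
  then obtain C where C: "\<And>x. x \<in> K \<Longrightarrow> norm (u x) \<le> C"
    by (metis compact_imp_bounded bounded_iff imageI)
  have meas: "u \<in> borel_measurable M"
    using borel_measurable_continuous_onI[OF u] sets by (simp cong: measurable_cong_sets)
  show ?thesis
    by (rule integrableI_bounded_set[OF KM meas fin, of C]) (use C zero in auto)
qed


subsection \<open>Coordinates in a fibre\<close>

text \<open>The first component of the trivialization is the projection, so the bijection of total
  spaces restricts to one over each base point. This turns questions about fibre elements into
  questions about their coordinates.\<close>

lemma local_trivialization_bij_betw:
  assumes "local_trivialization E U n \<phi>" "b \<in> U"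
  shows "bij_betw \<phi> (fiber E b) {x. \<forall>i\<ge>n. x i = 0}"
proof -
  let ?m = "\<lambda>x. (proj E x, \<phi> x)"
  have hom: "homeomorphic_map (top_of_set (proj E -` U))
       (prod_topology (top_of_set U) (Euclidean_space n)) ?m"
    using assms(1) by (simp add: local_trivialization_def)
  have inj: "inj_on ?m (proj E -` U)"
    using homeomorphic_imp_injective_map[OF hom] by simp
  have surj: "?m ` (proj E -` U) = U \<times> {x. \<forall>i\<ge>n. x i = 0}"
    using homeomorphic_imp_surjective_map[OF hom] by (simp add: topspace_Euclidean_space)
  have "inj_on \<phi> (fiber E b)"
    using inj assms(2) by (auto simp: inj_on_def fiber_def)
  moreover have "\<phi> ` fiber E b \<subseteq> {x. \<forall>i\<ge>n. x i = 0}"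
    using surj assms(2) by (force simp: fiber_def)
  moreover have "x \<in> \<phi> ` fiber E b" if "x \<in> {x. \<forall>i\<ge>n. x i = 0}" for x
  proof -
    have "(b, x) \<in> ?m ` (proj E -` U)"
      using that assms(2) surj by blast
    then show ?thesis
      by (auto simp: fiber_def)
  qed
  ultimately show ?thesis
    by (auto simp: bij_betw_def)
qed

lemma local_trivialization_continuous:
  assumes triv: "local_trivialization E U n \<phi>" and b: "b \<in> U"
    and s: "continuous_on UNIV s" "\<And>k. s k \<in> fiber E b"
  shows "continuous_on UNIV (\<lambda>k. \<phi> (s k) i)"
proof -
  have "continuous_map (top_of_set (proj E -` U))
       (prod_topology (top_of_set U) (Euclidean_space n)) (\<lambda>x. (proj E x, \<phi> x))"
    using triv by (simp add: local_trivialization_def homeomorphic_imp_continuous_map)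
  then have "continuous_map (top_of_set (proj E -` U)) (Euclidean_space n) \<phi>"
    by (simp add: continuous_map_pairwise o_def)
  then have \<phi>: "continuous_map (top_of_set (proj E -` U)) euclideanreal (\<lambda>x. \<phi> x i)"
    by (simp add: Euclidean_space_def continuous_map_in_subtopology
        continuous_map_componentwise_UNIV)
  have "continuous_map euclidean (top_of_set (proj E -` U)) s"
    using s b by (auto simp: continuous_map_in_subtopology fiber_def)
  from continuous_map_compose[OF this \<phi>] show ?thesis
    by (simp add: o_def)
qed

lemma fiber_vector_space_closed:
  assumes "fiber_vector_space E b" "x \<in> fiber E b"
  shows "y \<in> fiber E b \<Longrightarrow> vadd E x y \<in> fiber E b" "vscale E c x \<in> fiber E b"
proof -
  have "\<forall>x\<in>fiber E b. \<forall>y\<in>fiber E b. vadd E x y \<in> fiber E b"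
    using assms(1) unfolding fiber_vector_space_def by (elim conjE) assumption
  then show "y \<in> fiber E b \<Longrightarrow> vadd E x y \<in> fiber E b"
    using assms(2) by blast
  have "\<forall>c. \<forall>x\<in>fiber E b. vscale E c x \<in> fiber E b"
    using assms(1) unfolding fiber_vector_space_def by (elim conjE) assumption
  then show "vscale E c x \<in> fiber E b"
    using assms(2) by blast
qed

lemma fiber_functional_vzero:
  assumes "fiber_vector_space E b" "fiber_functional E b l"
  shows "l (vzero E b) = 0"
proof -
  have z: "vzero E b \<in> fiber E b"
    using assms(1) unfolding fiber_vector_space_def by (elim conjE) assumption
  have "\<forall>x\<in>fiber E b. vadd E (vzero E b) x = x"
    using assms(1) unfolding fiber_vector_space_def by (elim conjE) assumption
  with z have "vadd E (vzero E b) (vzero E b) = vzero E b"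
    by blast
  with z have "l (vzero E b) = l (vzero E b) + l (vzero E b)"
    using assms(2) unfolding fiber_functional_def by metis
  then show ?thesis by simp
qed

lemma fiber_functional_comp:
  assumes "fiber_linear E b F c T" "fiber_functional F c l"
  shows "fiber_functional E b (\<lambda>v. l (T v))"
  using assms unfolding fiber_linear_def fiber_functional_def by simp

text \<open>This is the expansion of \<open>v\<close> in the basis that \<phi> pulls back from the
  standard basis. It reduces statements about all functionals to the finitely many
  coordinates.\<close>

lemma fiber_functional_coordinates:
  assumes vs: "fiber_vector_space E b" and triv: "local_trivialization E U n \<phi>" and b: "b \<in> U"
    and l: "fiber_functional E b l" and v: "v \<in> fiber E b"
  shows "l v = (\<Sum>j<n. \<phi> v j * l (inv_into (fiber E b) \<phi> (\<lambda>k. if k = j then 1 else 0)))"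
proof -
  define e where "e j = inv_into (fiber E b) \<phi> (\<lambda>k. if k = j then 1 else 0)" for j :: nat
  note bij = local_trivialization_bij_betw[OF triv b]
  have \<phi>: "fiber_functional E b (\<lambda>x. \<phi> x i)" for i
    using triv b by (simp add: local_trivialization_def)
  have add: "vadd E x y \<in> fiber E b" if "x \<in> fiber E b" "y \<in> fiber E b" for x y
    using fiber_vector_space_closed(1)[OF vs that] .
  have scale: "vscale E c x \<in> fiber E b" if "x \<in> fiber E b" for x c
    using fiber_vector_space_closed(2)[OF vs that] .
  have e: "e j \<in> fiber E b" "\<phi> (e j) = (\<lambda>k. if k = j then 1 else 0)" if "j < n" for j
  proof -
    have "(\<lambda>k. if k = j then 1 else 0) \<in> \<phi> ` fiber E b"
      using bij that by (auto simp: bij_betw_def)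
    then show "e j \<in> fiber E b" "\<phi> (e j) = (\<lambda>k. if k = j then 1 else 0)"
      unfolding e_def by (rule inv_into_into, rule f_inv_into_f)
  qed
  \<comment> \<open>Generalized for induction: \<open>p\<close> bounds the indices at which
    \<open>v\<close> may have nonzero coordinates, and \<open>p = n\<close> is the claim.\<close>
  have "l v = (\<Sum>j<p. \<phi> v j * l (e j))"
    if "p \<le> n" "v \<in> fiber E b" "\<forall>i\<ge>p. \<phi> v i = 0" for p v
    using that
  proof (induction p arbitrary: v)
    case 0
    \<comment> \<open>All coordinates of \<open>v\<close> vanish, so scaling by 0 does not change
      them. Injectivity of \<phi> then makes \<open>v\<close> its own zero multiple, which forces
      \<open>l v = 0\<close>.\<close>
    then have "\<phi> (vscale E 0 v) = \<phi> v"
      using \<phi> unfolding fiber_functional_def by (intro ext) simp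
    then have "vscale E 0 v = v"
      using bij 0 scale by (auto simp: bij_betw_def dest: inj_onD)
    then have "l v = 0 * l v"
      using l 0 unfolding fiber_functional_def by metis
    then show ?case by simp
  next
    case (Suc p)
    \<comment> \<open>Subtracting the \<open>p\<close>-th basis component kills coordinate
      \<open>p\<close> and leaves the others alone, so the induction hypothesis applies to
      \<open>u\<close>.\<close>
    define u where "u = vadd E v (vscale E (- \<phi> v p) (e p))"
    have p: "p < n" using Suc by simp
    have u: "u \<in> fiber E b"
      unfolding u_def using Suc e p by (intro add scale)
    have \<phi>u: "\<phi> u i = \<phi> v i - \<phi> v p * (if i = p then 1 else 0)" for i
      using \<phi>[of i] Suc.prems e[OF p] scale unfolding fiber_functional_def u_def by simp
    have lu: "l u = l v - \<phi> v p * l (e p)"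
      using l Suc.prems e[OF p] scale unfolding fiber_functional_def u_def by simp
    have "\<forall>i\<ge>p. \<phi> u i = 0"
    proof (intro allI impI)
      fix i assume "i \<ge> p"
      then show "\<phi> u i = 0"
        using Suc.prems(3) by (cases "i = p") (auto simp: \<phi>u)
    qed
    then have "l u = (\<Sum>j<p. \<phi> u j * l (e j))"
      using Suc.IH u p by simp
    also have "\<dots> = (\<Sum>j<p. \<phi> v j * l (e j))"
      by (intro sum.cong) (auto simp: \<phi>u)
    finally show ?case using lu by simp
  qed
  moreover have "\<forall>i\<ge>n. \<phi> v i = 0"
    using bij v by (auto simp: bij_betw_def)
  ultimately show ?thesis
    using v unfolding e_def by blast
qed


subsection \<open>Integrals in a fibre\<close>

lemma has_fiber_integralD:
  assumes "has_fiber_integral F b M s v" "fiber_functional F b l"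
  shows "has_bochner_integral M (\<lambda>k. l (s k)) (l v)"
  using assms unfolding has_fiber_integral_def by blast

text \<open>The witness is the fibre element whose coordinates are the integrals of the coordinates;
  any other functional is a linear combination of these.\<close>

lemma has_fiber_integral_exists:
  assumes vs: "fiber_vector_space F b" and triv: "local_trivialization F V m \<psi>" and b: "b \<in> V"
    and s: "\<And>k. s k \<in> fiber F b" and int: "\<And>i. integrable M (\<lambda>k. \<psi> (s k) i)"
  shows "\<exists>v. has_fiber_integral F b M s v"
proof -
  note bij = local_trivialization_bij_betw[OF triv b]
  \<comment> \<open>Coordinates from \<open>m\<close> on vanish, hence so do their integrals, and
    the sequence of integrals lies in the model fibre.\<close>
  have "\<psi> (s k) i = 0" if "i \<ge> m" for k i
    using bij s[of k] that by (auto simp: bij_betw_def)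
  then have "(\<lambda>i. \<integral>k. \<psi> (s k) i \<partial>M) \<in> \<psi> ` fiber F b"
    using bij by (auto simp: bij_betw_def)
  then obtain v where v: "v \<in> fiber F b" "\<psi> v = (\<lambda>i. \<integral>k. \<psi> (s k) i \<partial>M)"
    by (metis imageE)
  have "has_bochner_integral M (\<lambda>k. l (s k)) (l v)" if l: "fiber_functional F b l" for l
    unfolding fiber_functional_coordinates[OF vs triv b l s]
      fiber_functional_coordinates[OF vs triv b l v(1)] v(2)
    by (intro has_bochner_integral_sum has_bochner_integral_mult_left
        has_bochner_integral_integrable int)
  with v show ?thesis
    unfolding has_fiber_integral_def by blast
qed

text \<open>The coordinates of a local trivialization are fibre functionals, and together they
  separate the points of the fibre.\<close>

lemma has_fiber_integral_unique:
  assumes "vector_bundle F" and v: "has_fiber_integral F b M s v" and w: "has_fiber_integral F b M s w"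
  shows "v = w"
proof -
  obtain V m \<psi> where V: "b \<in> V" "local_trivialization F V m \<psi>"
    using assms(1) unfolding vector_bundle_def by blast
  have "\<psi> v i = \<psi> w i" for i
  proof (rule has_bochner_integral_eq)
    have \<psi>: "fiber_functional F b (\<lambda>x. \<psi> x i)"
      using V by (simp add: local_trivialization_def)
    show "has_bochner_integral M (\<lambda>k. \<psi> (s k) i) (\<psi> v i)"
      "has_bochner_integral M (\<lambda>k. \<psi> (s k) i) (\<psi> w i)"
      using has_fiber_integralD[OF v \<psi>] has_fiber_integralD[OF w \<psi>] .
  qed
  then have "\<psi> v = \<psi> w" by auto
  moreover have "v \<in> fiber F b" "w \<in> fiber F b"
    using v w by (simp_all add: has_fiber_integral_def)
  ultimately show ?thesis
    using local_trivialization_bij_betw[OF V(2,1)] by (auto simp: bij_betw_def dest: inj_onD)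
qed

lemma fiber_integral_eq:
  assumes "vector_bundle F" "has_fiber_integral F b M s v"
  shows "fiber_integral F b M s = v"
  unfolding fiber_integral_def
  using assms by (blast intro: has_fiber_integral_unique)

text \<open>Change of variables, checked functional by functional. Measurability of each functional
  of \<open>s\<close> comes from its integrability under the pushforward.\<close>

lemma has_fiber_integral_distr:
  assumes c: "c \<in> measurable M N" and v: "has_fiber_integral F b (distr M N c) s v"
  shows "has_fiber_integral F b M (\<lambda>k. s (c k)) v"
  unfolding has_fiber_integral_def
proof (intro conjI allI impI)
  show "v \<in> fiber F b"
    using v by (simp add: has_fiber_integral_def)
  fix l assume "fiber_functional F b l"
  then have l: "has_bochner_integral (distr M N c) (\<lambda>k. l (s k)) (l v)"
    by (rule has_fiber_integralD[OF v])
  have meas: "(\<lambda>k. l (s k)) \<in> borel_measurable N"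
    using borel_measurable_has_bochner_integral[OF l] by simp
  show "has_bochner_integral M (\<lambda>k. l (s (c k))) (l v)"
    using l integrable_distr_eq[OF c meas] integral_distr[OF c meas]
    unfolding has_bochner_integral_iff by simp
qed

text \<open>Composing a functional on the target fibre with \<open>T\<close> gives one on the source
  fibre, where the given integral can be tested.\<close>

lemma has_fiber_integral_linear:
  assumes "fiber_linear F b F' c T" "has_fiber_integral F b M s v"
  shows "has_fiber_integral F' c M (\<lambda>k. T (s k)) (T v)"
  unfolding has_fiber_integral_def
proof (intro conjI allI impI)
  show "T v \<in> fiber F' c"
    using assms by (simp add: has_fiber_integral_def fiber_linear_def)
  fix l assume "fiber_functional F' c l"
  from has_fiber_integralD[OF assms(2) fiber_functional_comp[OF assms(1) this]]
  show "has_bochner_integral M (\<lambda>k. l (T (s k))) (l (T v))" .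
qed


subsection \<open>The convolution\<close>

text \<open>Continuity of \<omega> into the total space of the Hom bundle is read off in one bundle
  chart, with the base point held fixed.\<close>

lemma continuous_hom_matrix:
  fixes \<omega> :: "'g::topological_space \<Rightarrow> 'b::topological_space \<Rightarrow> 'e::topological_space \<Rightarrow> 'f::topological_space"
  assumes \<omega>: "continuous_map euclidean (hom_topology E F) (\<lambda>(h, b). (b, \<omega> h b))"
    and fib: "\<And>h b. \<omega> h b \<in> hom_fiber E F b"
    and U: "b \<in> U" "local_trivialization E U n \<phi>" and V: "b \<in> V" "local_trivialization F V m \<psi>"
  shows "continuous_on UNIV (\<lambda>k. hom_matrix E n \<phi> \<psi> b (\<omega> k b))"
  unfolding continuous_on_open_vimage[OF open_UNIV] Int_UNIV_right
proof (intro allI impI)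
  fix W :: "(nat \<times> nat \<Rightarrow> real) set" assume W: "open W"
  \<comment> \<open>A generator of the Hom topology: the chart preimage of
    \<open>UNIV \<times> W\<close>, which constrains the matrix alone. The bound \<open>b\<close>
    here shadows the fixed base point.\<close>
  define S where "S = {(b, T). b \<in> U \<inter> V \<and> T \<in> hom_fiber E F b \<and>
      (b, hom_matrix E n \<phi> \<psi> b T) \<in> UNIV \<times> W}"
  have "openin (hom_topology E F) S"
    unfolding hom_topology_def S_def
    by (rule topology_generated_by_Basis) (use U V W open_Times[OF open_UNIV W] in blast)
  moreover have "continuous_map euclidean (hom_topology E F) (\<lambda>k. (b, \<omega> k b))"
  proof -
    have "continuous_map euclidean euclidean (\<lambda>k::'g. (k, b))"
      by (auto intro!: continuous_intros)
    from continuous_map_compose[OF this \<omega>] show ?thesis by (simp add: o_def)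
  qed
  ultimately have "open {k. (b, \<omega> k b) \<in> S}"
    using openin_continuous_map_preimage by fastforce
  also have "{k. (b, \<omega> k b) \<in> S} = (\<lambda>k. hom_matrix E n \<phi> \<psi> b (\<omega> k b)) -` W"
    using U V fib by (auto simp: S_def)
  finally show "open ((\<lambda>k. hom_matrix E n \<phi> \<psi> b (\<omega> k b)) -` W)" .
qed

lemma mackey_conv_integral_exists:
  fixes actB :: "'g::{topological_group_add, t2_space} \<Rightarrow> 'b::t2_space \<Rightarrow> 'b"
    and E :: "('b, 'e::topological_space) vbundle" and F :: "('b, 'f::topological_space) vbundle"
  assumes E: "vector_bundle E" and F: "vector_bundle F"
    and M: "locally_finite_borel_measure M"
    and \<omega>: "mackey_filter actB E actE F actF \<omega>"
    and f: "mackey_section actB E actE f" "continuous_on UNIV f"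
  shows "\<exists>v. has_fiber_integral F b M (\<lambda>k. \<omega> k b (f (h + k, b))) v"
proof -
  obtain U n \<phi> where U: "b \<in> U" "local_trivialization E U n \<phi>"
    using E unfolding vector_bundle_def by blast
  obtain V m \<psi> where V: "b \<in> V" "local_trivialization F V m \<psi>"
    using F unfolding vector_bundle_def by blast
  have vsE: "fiber_vector_space E b" and vsF: "fiber_vector_space F b"
    using E F by (simp_all add: vector_bundle_def)
  have hom: "\<And>k b. \<omega> k b \<in> hom_fiber E F b"
    using \<omega> by (simp add: mackey_filter_def)
  then have lin: "fiber_linear E b F b (\<omega> k b)" for k
    by (simp add: hom_fiber_def)
  have f_fib: "f (k, b) \<in> fiber E b" for k
    using f(1) by (simp add: mackey_section_def)
  have \<psi>: "fiber_functional F b (\<lambda>x. \<psi> x i)" for i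
    using V by (simp add: local_trivialization_def)
  have mat: "continuous_on UNIV (\<lambda>k. hom_matrix E n \<phi> \<psi> b (\<omega> k b) (i, j))" for i j
    by (rule continuous_on_product_then_coordinatewise[OF continuous_hom_matrix[OF _ hom U V]])
      (use \<omega> in \<open>simp add: mackey_filter_def\<close>)
  have "continuous_on UNIV (\<lambda>k. f (h + k, b))"
    by (intro continuous_on_compose2[OF f(2)] continuous_intros) auto
  then have \<phi>f: "continuous_on UNIV (\<lambda>k. \<phi> (f (h + k, b)) j)" for j
    by (rule local_trivialization_continuous[OF U(2,1)]) (rule f_fib)
  show ?thesis
  proof (rule has_fiber_integral_exists[OF vsF V(2,1)])
    show "\<omega> k b (f (h + k, b)) \<in> fiber F b" for k
      using lin f_fib by (simp add: fiber_linear_def)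
    fix i
    \<comment> \<open>Row \<open>i\<close> of the matrix of \<open>\<omega> k b\<close> times the
      coordinate vector of the section value, obtained by expanding the functional that sends
      \<open>v\<close> to \<open>\<psi> (\<omega> k b v) i\<close>.\<close>
    have eq: "\<psi> (\<omega> k b (f (h + k, b))) i =
        (\<Sum>j<n. \<phi> (f (h + k, b)) j * hom_matrix E n \<phi> \<psi> b (\<omega> k b) (i, j))" for k
      using fiber_functional_coordinates[OF vsE U(2,1) fiber_functional_comp[OF lin \<psi>] f_fib]
      by (simp add: hom_matrix_def)
    have cont: "continuous_on UNIV (\<lambda>k. \<psi> (\<omega> k b (f (h + k, b))) i)"
      unfolding eq by (intro continuous_on_sum continuous_on_mult \<phi>f mat)
    show "integrable M (\<lambda>k. \<psi> (\<omega> k b (f (h + k, b))) i)"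
    proof (rule continuous_compact_support_integrable[OF M cont])
      show "compact (closure {k. \<exists>v\<in>fiber E b. \<omega> k b v \<noteq> vzero F b})"
        using \<omega> by (simp add: mackey_filter_def)
      fix k assume "k \<notin> closure {k. \<exists>v\<in>fiber E b. \<omega> k b v \<noteq> vzero F b}"
      then have "k \<notin> {k. \<exists>v\<in>fiber E b. \<omega> k b v \<noteq> vzero F b}"
        by (meson closure_subset subsetD)
      then have "\<omega> k b (f (h + k, b)) = vzero F b"
        using f_fib[of "h + k"] by simp
      then show "\<psi> (\<omega> k b (f (h + k, b))) i = 0"
        using fiber_functional_vzero[OF vsF \<psi>] by simp
    qed
  qed
qed

theorem lemma2p7:
  fixes actB :: "'g::{topological_group_add, t2_space} \<Rightarrow> 'b::t2_space \<Rightarrow> 'b"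
    and E :: "('b, 'e::topological_space) vbundle" and actE :: "'g \<Rightarrow> 'e \<Rightarrow> 'e"
    and F :: "('b, 'f::topological_space) vbundle" and actF :: "'g \<Rightarrow> 'f \<Rightarrow> 'f"
    and \<mu> :: "'b \<Rightarrow> 'g measure"
    and \<omega> :: "'g \<Rightarrow> 'b \<Rightarrow> 'e \<Rightarrow> 'f"
  assumes "continuous_group_action actB"
    and "equivariant_vector_bundle actB E actE"
    and "equivariant_vector_bundle actB F actF"
    and "\<And>b. locally_finite_borel_measure (\<mu> b)"
    and "equivariant_measure_family actB \<mu>"
    and "continuous_measure_family \<mu>"
    and "mackey_filter actB E actE F actF \<omega>"
  shows "\<forall>f. mackey_section actB E actE f \<and> continuous_on UNIV f \<longrightarrow>
           (\<forall>h b. \<exists>v. has_fiber_integral F b (\<mu> b) (\<lambda>k. \<omega> k b (f (h + k, b))) v) \<and>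
           mackey_section actB F actF (mackey_conv F \<mu> \<omega> f) \<and>
           (\<forall>g. mackey_conv F \<mu> \<omega> (mackey_act g f) = mackey_act g (mackey_conv F \<mu> \<omega> f))"
proof (intro allI impI)
  fix f assume "mackey_section actB E actE f \<and> continuous_on UNIV f"
  then have f: "mackey_section actB E actE f" "continuous_on UNIV f" by auto
  have vE: "vector_bundle E" and vF: "vector_bundle F"
    using assms(2,3) by (simp_all add: equivariant_vector_bundle_def)
  note ex = mackey_conv_integral_exists[OF vE vF assms(4,7) f]
  \<comment> \<open>Existence and uniqueness ensure that the definite description in
    \<open>fiber_integral\<close> denotes the actual integral.\<close>
  have conv: "has_fiber_integral F b (\<mu> b) (\<lambda>k. \<omega> k b (f (h + k, b))) (mackey_conv F \<mu> \<omega> f (h, b))"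
    for h b
    using ex[of b b h] fiber_integral_eq[OF vF] by (auto simp: mackey_conv_def)
  have "mackey_section actB F actF (mackey_conv F \<mu> \<omega> f)"
    unfolding mackey_section_def
  proof (intro conjI allI)
    fix h b
    show "mackey_conv F \<mu> \<omega> f (h, b) \<in> fiber F b"
      using conv by (simp add: has_fiber_integral_def)
  next
    fix g h :: 'g and b
    define c where "c k = g + k - g" for k
    have "continuous_on UNIV c"
      unfolding c_def by (intro continuous_intros)
    then have c: "c \<in> measurable (\<mu> b) borel"
      using assms(4)[of b] borel_measurable_continuous_onI
      by (auto simp: locally_finite_borel_measure_def cong: measurable_cong_sets)
    have \<mu>: "\<mu> (actB g b) = distr (\<mu> b) borel c"
      using assms(5) by (simp add: equivariant_measure_family_def c_def[abs_def])
    have "\<omega> (c k) (actB g b) (f (h + c k, actB g b)) = actF g (\<omega> k b (f (h + g + k, b)))" for k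
    proof -
      have "f (h + c k, actB g b) = actE g (f (h + g + k, b))"
        using f(1) by (simp add: mackey_section_def c_def algebra_simps)
      moreover have "f (h + g + k, b) \<in> fiber E b"
        using f(1) by (simp add: mackey_section_def)
      ultimately show ?thesis
        using assms(7) by (simp add: mackey_filter_def c_def)
    qed
    then have "has_fiber_integral F (actB g b) (\<mu> b) (\<lambda>k. actF g (\<omega> k b (f (h + g + k, b))))
        (mackey_conv F \<mu> \<omega> f (h, actB g b))"
      using has_fiber_integral_distr[OF c conv[of "actB g b" h, unfolded \<mu>]] by simp
    moreover have "fiber_linear F b F (actB g b) (actF g)"
      using assms(3) by (simp add: equivariant_vector_bundle_def)
    \<comment> \<open>Both sides are integrals of the same translated integrand against
      \<open>\<mu> b\<close>, the right one by linearity of \<open>actF g\<close> on the fibre, so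
      uniqueness identifies them.\<close>
    ultimately show "mackey_conv F \<mu> \<omega> f (h, actB g b) = actF g (mackey_conv F \<mu> \<omega> f (h + g, b))"
      by (intro has_fiber_integral_unique[OF vF _ has_fiber_integral_linear[OF _ conv]])
  qed
  \<comment> \<open>Left translation acts on the argument \<open>h\<close> and convolution shifts it
    on the right, so the two integrands agree after reassociating
    \<open>- g + h + k\<close>.\<close>
  moreover have "mackey_conv F \<mu> \<omega> (mackey_act g f) = mackey_act g (mackey_conv F \<mu> \<omega> f)" for g
    by (simp add: fun_eq_iff mackey_conv_def mackey_act_def add.assoc)
  ultimately show "(\<forall>h b. \<exists>v. has_fiber_integral F b (\<mu> b) (\<lambda>k. \<omega> k b (f (h + k, b))) v) \<and>
      mackey_section actB F actF (mackey_conv F \<mu> \<omega> f) \<and>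
      (\<forall>g. mackey_conv F \<mu> \<omega> (mackey_act g f) = mackey_act g (mackey_conv F \<mu> \<omega> f))"
    using conv by blast
qed

end
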